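(* Let $(X,\operatorname{dist})$ be a totally disconnected compact metric space and let $f\colon X\to X$ be a separating homeomorphism. Then $f$ is finite expansive and, moreover, there is $\epsilon>0$ such that for every $x\in X$, if $\Gamma_\epsilon(x)\neq\{x\}$ then $x$ is a periodic point of $f$.
   Context: Let $f\colon X\to X$ be a homeomorphism of a compact metric space $(X,\operatorname{dist})$. The orbit of $x\in X$ is $O(x)=\{f^n(x):n\in\mathbb Z\}$. A point $x$ is periodic if $f^n(x)=x$ for some integer $n\neq 0$. The homeomorphism $f$ is separating if there is $\eta>0$ such that whenever $x,y\in X$ and $y\notin O(x)$, one has $\operatorname{dist}(f^n(x),f^n(y))>\eta$ for some $n\in\mathbb Z$. For $x\in X$ and $\eta>0$ let $\Gamma_\eta(x)=\{y\in X:\operatorname{dist}(f^k(x),f^k(y))\leq\eta\text{ for all }k\in\mathbb Z\}$. The homeomorphism $f$ is finite expansive if there is $\eta>0$ such that $\Gamma_\eta(x)$ is a finite set for every $x\in X$. *)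

theory Defs
  imports "HOL-Analysis.Analysis"
begin

text \<open>
  A metric space is a subset \<open>X\<close> of a type of class \<open>metric_space\<close>, with the restricted distance;
  self-maps of \<open>X\<close> are total functions on the type, of which only the values on \<open>X\<close> matter.
\<close>

definition totally_disconnected :: "'a::topological_space set \<Rightarrow> bool" where
  "totally_disconnected X \<longleftrightarrow> (\<forall>x\<in>X. connected_component_set X x = {x})"

definition self_homeomorphism :: "'a::topological_space set \<Rightarrow> ('a \<Rightarrow> 'a) \<Rightarrow> bool" where
  "self_homeomorphism X f \<longleftrightarrow> (\<exists>g. homeomorphism X X f g)"

text \<open>
  The integer iterate of a bijection \<open>f\<close> of \<open>X\<close>, meaningful at points of \<open>X\<close>. The inverse is taken
  relative to \<open>X\<close>, as \<open>f\<close> need not be injective on the whole type.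
\<close>

definition iter :: "'a set \<Rightarrow> ('a \<Rightarrow> 'a) \<Rightarrow> int \<Rightarrow> 'a \<Rightarrow> 'a" where
  "iter X f n = (if 0 \<le> n then f ^^ nat n else inv_into X f ^^ nat (- n))"

definition orbit :: "'a set \<Rightarrow> ('a \<Rightarrow> 'a) \<Rightarrow> 'a \<Rightarrow> 'a set" where
  "orbit X f x = {iter X f n x | n. True}"

definition periodic_point :: "'a set \<Rightarrow> ('a \<Rightarrow> 'a) \<Rightarrow> 'a \<Rightarrow> bool" where
  "periodic_point X f x \<longleftrightarrow> x \<in> X \<and> (\<exists>n. n \<noteq> 0 \<and> iter X f n x = x)"

definition separating :: "'a::metric_space set \<Rightarrow> ('a \<Rightarrow> 'a) \<Rightarrow> bool" where
  "separating X f \<longleftrightarrow>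
     (\<exists>\<eta>>0. \<forall>x\<in>X. \<forall>y\<in>X. y \<notin> orbit X f x \<longrightarrow> (\<exists>n. dist (iter X f n x) (iter X f n y) > \<eta>))"

definition dyn_ball :: "'a::metric_space set \<Rightarrow> ('a \<Rightarrow> 'a) \<Rightarrow> real \<Rightarrow> 'a \<Rightarrow> 'a set" where
  "dyn_ball X f \<eta> x = {y \<in> X. \<forall>k. dist (iter X f k x) (iter X f k y) \<le> \<eta>}"

definition finite_expansive :: "'a::metric_space set \<Rightarrow> ('a \<Rightarrow> 'a) \<Rightarrow> bool" where
  "finite_expansive X f \<longleftrightarrow> (\<exists>\<eta>>0. \<forall>x\<in>X. finite (dyn_ball X f \<eta> x))"

end

theory Submission
  imports Defs
begin

text \<open>
  Let \<open>\<eta>\<close> be a separating constant, so that the set \<open>\<Gamma>\<^sub>\<eta>(x)\<close> of points that stay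
  \<open>\<eta>\<close>-close to \<open>x\<close> lies in the orbit of \<open>x\<close>. Total disconnectedness provides symbolic coding: there
  is a colouring of \<open>X\<close> for which sufficiently close points, at distance at most \<open>\<delta>\<close>, have
  the same colour, while points of one colour are \<open>\<eta>\<close>-close (\<open>fine_locally_constant_colouring\<close>).

  Take \<open>\<epsilon>\<close> to be the minimum of \<open>\<delta>\<close> and \<open>\<eta>\<close>, and suppose that
  \<open>\<Gamma>\<^sub>\<epsilon>(x)\<close> contains a point \<open>y \<noteq> x\<close>. Then \<open>y = f\<^sup>n(x)\<close> for some \<open>n \<noteq> 0\<close>, and
  \<open>f\<^sup>k(x)\<close> and \<open>f\<^sup>k\<^sup>+\<^sup>n(x)\<close> have the same colour for all \<open>k\<close>: the itinerary of \<open>x\<close> has period \<open>n\<close>.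
  Hence all points \<open>f\<^sup>j\<^sup>n(x)\<close> share the itinerary of \<open>x\<close> and belong to \<open>\<Gamma>\<^sub>\<eta>(x)\<close>. This
  set is closed and lies in the orbit, so the closure of the \<open>f\<^sup>n\<close>-orbit of \<open>x\<close> is part of
  the \<open>f\<close>-orbit of \<open>x\<close>. The \<open>f\<close>-orbit is a finite union of images of that closure, so it is
  compact (\<open>compact_orbit_if_closure_in_orbit\<close>). Being also countable, it has an isolated point by
  Baire's theorem; the iterates act transitively on it by homeomorphisms, so it is discrete, hence
  finite (\<open>finite_compact_orbit\<close>).

  A finite orbit yields both conclusions: \<open>x\<close> is periodic, and \<open>\<Gamma>\<^sub>\<epsilon>(x)\<close>, a subset of the orbit,
  is finite.
\<close>

section \<open>The action of the integers by iterates\<close>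

lemma iter_0 [simp]: "iter X f 0 x = x"
  by (simp add: iter_def)

lemma iter_in:
  assumes "self_homeomorphism X f" "x \<in> X"
  shows "iter X f n x \<in> X"
proof -
  have f: "f ` X = X"
    using assms(1) by (auto simp: self_homeomorphism_def homeomorphism_def)
  have "(f ^^ k) x \<in> X" for k
    using f assms(2) by (induction k) auto
  moreover have "(inv_into X f ^^ k) x \<in> X" for k
    using f assms(2) by (induction k) (auto simp: inv_into_into)
  ultimately show ?thesis
    by (simp add: iter_def)
qed

lemma iter_Suc:
  assumes "self_homeomorphism X f" "x \<in> X"
  shows "iter X f (n + 1) x = f (iter X f n x)"
proof (cases "0 \<le> n")
  case True
  then have "nat (n + 1) = Suc (nat n)" by simp
  with True show ?thesis by (simp add: iter_def)
next
  case False
  have f: "f ` X = X"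
    using assms(1) by (auto simp: self_homeomorphism_def homeomorphism_def)
  have "nat (- n) = Suc (nat (- (n + 1)))"
    using False by simp
  then have "iter X f n x = inv_into X f (iter X f (n + 1) x)"
    using False by (auto simp: iter_def)
  then show ?thesis
    using iter_in [OF assms, of "n + 1"] f by (simp add: f_inv_into_f)
qed

lemma iter_add:
  assumes "self_homeomorphism X f" "x \<in> X"
  shows "iter X f (m + n) x = iter X f m (iter X f n x)"
proof (induction m rule: int_induct [where k = 0])
  case base
  show ?case by simp
next
  case (step1 i)
  then show ?case
    using iter_Suc [OF assms, of "i + n"] iter_Suc [OF assms(1) iter_in [OF assms, of n], of i]
    by (simp add: algebra_simps)
next
  case (step2 i)
  have inj: "inj_on f X"
    using assms(1) unfolding self_homeomorphism_def homeomorphism_def by (metis inj_on_inverseI)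
  have "f (iter X f (i - 1 + n) x) = f (iter X f (i - 1) (iter X f n x))"
    using step2 iter_Suc [OF assms, of "i - 1 + n"]
      iter_Suc [OF assms(1) iter_in [OF assms, of n], of "i - 1"]
    by (simp add: algebra_simps)
  then show ?case
    using inj assms by (simp add: inj_on_eq_iff iter_in)
qed

lemma continuous_on_iter:
  assumes "self_homeomorphism X f"
  shows "continuous_on X (iter X f n)"
proof -
  obtain g where g: "homeomorphism X X f g"
    using assms by (auto simp: self_homeomorphism_def)
  have X: "f ` X = X" "g ` X = X" and gf: "\<And>x. x \<in> X \<Longrightarrow> g (f x) = x" "\<And>x. x \<in> X \<Longrightarrow> f (g x) = x"
    and cf: "continuous_on X f" and cg: "continuous_on X g"
    using g by (auto simp: homeomorphism_def)
  have "inv_into X f x = g x" if "x \<in> X" for x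
    using that X gf by (metis imageI inj_on_inverseI inv_into_f_eq)
  then have ci: "continuous_on X (inv_into X f)"
    using cg continuous_on_cong by metis
  have pow: "continuous_on X (h ^^ k) \<and> (h ^^ k) ` X \<subseteq> X"
    if "continuous_on X h" "h ` X \<subseteq> X" for h :: "'a \<Rightarrow> 'a" and k
  proof (induction k)
    case (Suc k)
    then have "continuous_on X (h \<circ> (h ^^ k))"
      by (metis continuous_on_compose continuous_on_subset that(1))
    with Suc that show ?case by auto
  qed (auto simp: id_def)
  have "inv_into X f ` X \<subseteq> X"
    using X by (auto simp: inv_into_into)
  with pow [OF cf] pow [OF ci] X show ?thesis
    by (auto simp: iter_def)
qed

lemma orbit_subset:
  assumes "self_homeomorphism X f" "x \<in> X"
  shows "orbit X f x \<subseteq> X"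
  using iter_in [OF assms] by (auto simp: orbit_def)

lemma orbit_eq_range: "orbit X f x = range (\<lambda>n. iter X f n x)"
  by (auto simp: orbit_def)

lemma periodic_point_if_finite_orbit:
  assumes hom: "self_homeomorphism X f" and x: "x \<in> X" and fin: "finite (orbit X f x)"
  shows "periodic_point X f x"
proof -
  have "\<not> inj (\<lambda>n. iter X f n x)"
    using fin by (metis orbit_eq_range finite_imageD infinite_UNIV_int)
  then obtain m n where "m \<noteq> n" and eq: "iter X f m x = iter X f n x"
    by (auto simp: inj_def)
  have "iter X f (m - n) x = iter X f (- n) (iter X f m x)"
    using iter_add [OF hom x, of "- n" m] by simp
  also have "\<dots> = x"
    using iter_add [OF hom x, of "- n" n] by (simp add: eq)
  finally show ?thesis
    using x \<open>m \<noteq> n\<close> by (auto simp: periodic_point_def intro!: exI [of _ "m - n"])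
qed

lemma closed_dyn_ball:
  assumes "compact X" "self_homeomorphism X f"
  shows "closed (dyn_ball X f \<eta> x)"
proof -
  have "dyn_ball X f \<eta> x = X \<inter> (\<Inter>k. {y \<in> X. dist (iter X f k x) (iter X f k y) \<le> \<eta>})"
    by (auto simp: dyn_ball_def)
  moreover have "closed {y \<in> X. dist (iter X f k x) (iter X f k y) \<le> \<eta>}" for k
    using compact_imp_closed [OF assms(1)]
    by (intro continuous_closed_preimage_constant continuous_on_closed_Collect_le
        continuous_intros continuous_on_iter assms)
  ultimately show ?thesis
    using compact_imp_closed [OF assms(1)] by (simp only: closed_Int closed_INT ball_UNIV simp_thms)
qed

section \<open>Compact orbits\<close>

text \<open>
  Otherwise the singletons of points of \<open>K\<close> would be countably many closed sets with empty interior
  that cover \<open>K\<close>, against Baire's theorem.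
\<close>

lemma countable_compact_has_isolated_point:
  fixes K :: "'a::metric_space set"
  assumes "compact K" "countable K" "K \<noteq> {}"
  obtains p where "p \<in> K" "openin (top_of_set K) {p}"
proof (rule ccontr)
  assume "\<not> thesis"
  with that have no: "\<And>p. p \<in> K \<Longrightarrow> \<not> openin (top_of_set K) {p}"
    by blast
  have "top_of_set K interior_of \<Union>((\<lambda>p. {p}) ` K) = {}"
  proof (rule Baire_category_alt)
    show "completely_metrizable_space (top_of_set K) \<or>
        locally_compact_space (top_of_set K) \<and> regular_space (top_of_set K)"
      using assms(1)
      by (simp add: Hausdorff_space_subtopology compact_imp_locally_compact_space
          compact_space_subtopology locally_compact_Hausdorff_imp_regular_space)
    show "countable ((\<lambda>p. {p}) ` K)"
      using assms(2) by simp
    show "closedin (top_of_set K) T \<and> top_of_set K interior_of T = {}" if "T \<in> (\<lambda>p. {p}) ` K" for T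
    proof -
      from that obtain p where p: "p \<in> K" "T = {p}" by auto
      have "top_of_set K interior_of T \<noteq> {p}"
        using no p by (metis openin_interior_of)
      with p interior_of_subset [of "top_of_set K" T] show ?thesis
        by (auto simp: closedin_closed intro!: exI [of _ "{p}"])
    qed
  qed
  moreover have "\<Union>((\<lambda>p. {p}) ` K) = topspace (top_of_set K)"
    by auto
  ultimately show False
    using assms(3) by (simp only: interior_of_topspace) simp
qed

text \<open>
  An isolated point of the orbit can be moved to any other point of it by an iterate of \<open>f\<close>, which
  restricts to a homeomorphism of the orbit. So all points are isolated, and compactness leaves only
  finitely many.
\<close>

lemma finite_compact_orbit:
  fixes X :: "'a::metric_space set"
  assumes hom: "self_homeomorphism X f" and x: "x \<in> X" and comp: "compact (orbit X f x)"
  shows "finite (orbit X f x)"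
proof -
  let ?O = "orbit X f x"
  have "countable ?O" "?O \<noteq> {}"
    by (auto simp: orbit_eq_range)
  then obtain p where p: "p \<in> ?O" and iso: "openin (top_of_set ?O) {p}"
    using countable_compact_has_isolated_point [OF comp] by blast
  have sub: "?O \<subseteq> X"
    by (rule orbit_subset [OF hom x])
  have "openin (top_of_set ?O) {q}" if q: "q \<in> ?O" for q
  proof -
    obtain i j where ij: "p = iter X f i x" "q = iter X f j x"
      using p q by (auto simp: orbit_eq_range)
    let ?h = "iter X f (i - j)"
    have "continuous_on ?O ?h"
      using continuous_on_subset [OF continuous_on_iter [OF hom] sub] .
    moreover have "?h \<in> ?O \<rightarrow> ?O"
      by (auto simp: orbit_eq_range iter_add [OF hom x, symmetric])
    ultimately have "openin (top_of_set ?O) (?O \<inter> ?h -` {p})"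
      using continuous_openin_preimage iso by blast
    moreover have "?O \<inter> ?h -` {p} = {q}"
    proof -
      have hq: "?h q = p"
        using iter_add [OF hom x, of "i - j" j] by (simp add: ij)
      have "r = q" if "r \<in> X" "?h r = p" for r
      proof -
        have "r = iter X f (j - i) p"
          using iter_add [OF hom \<open>r \<in> X\<close>, of "j - i" "i - j"] that by simp
        also have "\<dots> = q"
          using iter_add [OF hom, of q "j - i" "i - j"] hq q sub by auto
        finally show ?thesis .
      qed
      with hq q sub show ?thesis by auto
    qed
    ultimately show ?thesis by simp
  qed
  then have "discrete ?O"
    unfolding discrete_def isolated_in_def openin_open by (metis Int_commute)
  with comp show ?thesis
    using discrete_compact_finite_iff by blast
qed

section \<open>Colouring a totally disconnected compact space\<close>

text \<open>
  In a compact Hausdorff space the connected components are the quasi-components, that is, the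
  intersections of clopen sets; here they are single points.
\<close>

lemma clopen_separation:
  fixes X :: "'a::metric_space set"
  assumes comp: "compact X" and td: "totally_disconnected X"
    and "a \<in> X" "b \<in> X" "a \<noteq> b"
  obtains T where "openin (top_of_set X) T" "closedin (top_of_set X) T" "a \<in> T" "b \<notin> T"
proof -
  have "quasi_components_of (top_of_set X) = connected_components_of (top_of_set X)"
    using comp by (intro quasi_eq_connected_components_of)
      (simp add: compact_space_subtopology Hausdorff_space_subtopology)
  then have "quasi_component_of (top_of_set X) a = connected_component_of (top_of_set X) a"
    using \<open>a \<in> X\<close> by (simp add: quasi_eq_connected_components_of_pointwise)
  moreover have "\<not> connected_component_of (top_of_set X) a b"
  proof
    assume "connected_component_of (top_of_set X) a b"
    then have "b \<in> connected_component_set X a"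
      by (auto simp: connected_component_of_def connected_component_def connectedin_subtopology)
    with td \<open>a \<in> X\<close> \<open>a \<noteq> b\<close> show False
      by (simp add: totally_disconnected_def)
  qed
  ultimately have "\<not> quasi_component_of (top_of_set X) a b"
    by simp
  with that \<open>a \<in> X\<close> \<open>b \<in> X\<close> show thesis
    unfolding quasi_component_of by auto
qed

text \<open>
  The constant is a Lebesgue number of the open cover of \<open>X\<close> by \<open>T\<close> and its complement.
\<close>

lemma clopen_uniformly_separated:
  fixes X :: "'a::metric_space set"
  assumes "compact X" "openin (top_of_set X) T" "closedin (top_of_set X) T"
  obtains e where "e > 0" "\<And>u v. u \<in> X \<Longrightarrow> v \<in> X \<Longrightarrow> dist u v < e \<Longrightarrow> u \<in> T \<longleftrightarrow> v \<in> T"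
proof -
  obtain U V where U: "open U" "T = X \<inter> U" and V: "open V" "X - T = X \<inter> V"
    using assms(2,3) by (auto simp: openin_open closedin_def)
  have "X \<subseteq> \<Union>{U, V}"
    using U V by blast
  then obtain e where "e > 0" and e: "\<And>u. u \<in> X \<Longrightarrow> \<exists>G\<in>{U, V}. ball u e \<subseteq> G"
    using Heine_Borel_lemma [OF assms(1), of "{U, V}"] U V by blast
  have "u \<in> T \<longleftrightarrow> v \<in> T" if uv: "u \<in> X" "v \<in> X" "dist u v < e" for u v
  proof -
    have "{u, v} \<subseteq> ball u e"
      using uv \<open>e > 0\<close> by simp
    then have "{u, v} \<subseteq> U \<or> {u, v} \<subseteq> V"
      using e [OF \<open>u \<in> X\<close>] by blast
    with uv U V show ?thesis by blast
  qed
  with \<open>e > 0\<close> that show thesis by blast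
qed

text \<open>
  The compact set of pairs at distance at least \<open>\<eta>\<close> is covered by rectangles \<open>T \<times> (X - T)\<close> with \<open>T\<close>
  clopen. Finitely many of them suffice, and the colour of a point records which of the corresponding
  sets \<open>T\<close> contain it. The sequence of the colours of \<open>f\<^sup>k(x)\<close> then plays the role of an itinerary.
\<close>

lemma fine_locally_constant_colouring:
  fixes X :: "'a::metric_space set"
  assumes comp: "compact X" and td: "totally_disconnected X" and "\<eta> > 0"
  obtains \<epsilon> and c :: "'a \<Rightarrow> 'a set set"
  where "\<epsilon> > 0"
    and "\<And>u v. u \<in> X \<Longrightarrow> v \<in> X \<Longrightarrow> dist u v \<le> \<epsilon> \<Longrightarrow> c u = c v"
    and "\<And>u v. u \<in> X \<Longrightarrow> v \<in> X \<Longrightarrow> c u = c v \<Longrightarrow> dist u v < \<eta>"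
proof -
  define D where "D = {p \<in> X \<times> X. \<eta> \<le> dist (fst p) (snd p)}"
  define \<C> where "\<C> = {T. openin (top_of_set X) T \<and> closedin (top_of_set X) T}"
  have "compact D"
  proof -
    have "D = (X \<times> X) \<inter> {p. \<eta> \<le> dist (fst p) (snd p)}"
      by (auto simp: D_def)
    moreover have "closed {p :: 'a \<times> 'a. \<eta> \<le> dist (fst p) (snd p)}"
      by (intro closed_Collect_le continuous_intros)
    ultimately show ?thesis
      using comp by (simp add: compact_Int_closed compact_Times)
  qed
  have "\<exists>T U V. T \<in> \<C> \<and> open U \<and> open V \<and> T = X \<inter> U \<and> X - T = X \<inter> V \<and> p \<in> U \<times> V" if "p \<in> D" for p
  proof -
    obtain a b where "p = (a, b)" "a \<in> X" "b \<in> X" "\<eta> \<le> dist a b"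
      using \<open>p \<in> D\<close> by (cases p) (auto simp: D_def)
    then have ab: "p = (a, b)" "a \<in> X" "b \<in> X" "a \<noteq> b"
      using \<open>\<eta> > 0\<close> by auto
    then obtain T where T: "T \<in> \<C>" "a \<in> T" "b \<notin> T"
      using clopen_separation [OF comp td] unfolding \<C>_def by blast
    obtain U where U: "open U" "T = X \<inter> U"
      using T by (auto simp: \<C>_def openin_open)
    have "openin (top_of_set X) (X - T)"
      using T by (auto simp: \<C>_def)
    then obtain V where V: "open V" "X - T = X \<inter> V"
      by (auto simp: openin_open)
    have "p \<in> U \<times> V"
      using ab T U V by auto
    with T U V show ?thesis by blast
  qed
  then obtain T U V where TUV: "\<And>p. p \<in> D \<Longrightarrow> T p \<in> \<C> \<and> open (U p) \<and> open (V p) \<and> T p = X \<inter> U p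
      \<and> X - T p = X \<inter> V p \<and> p \<in> U p \<times> V p"
    by metis
  have "D \<subseteq> (\<Union>p\<in>D. U p \<times> V p)"
    using TUV by blast
  moreover have "open (U p \<times> V p)" if "p \<in> D" for p
    using TUV [OF that] by (blast intro: open_Times)
  ultimately obtain F where F: "F \<subseteq> D" "finite F" "D \<subseteq> (\<Union>p\<in>F. U p \<times> V p)"
    using compactE_image [OF \<open>compact D\<close>, of D "\<lambda>p. U p \<times> V p"] by metis
  have "\<exists>e>0. \<forall>u\<in>X. \<forall>v\<in>X. dist u v < e \<longrightarrow> (u \<in> T p \<longleftrightarrow> v \<in> T p)" if "p \<in> F" for p
  proof -
    have "openin (top_of_set X) (T p)" "closedin (top_of_set X) (T p)"
      using TUV [of p] F(1) that by (auto simp: \<C>_def)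
    with comp show ?thesis
      by (rule clopen_uniformly_separated) blast
  qed
  then obtain e where e: "\<And>p. p \<in> F \<Longrightarrow> e p > 0"
    "\<And>p u v. p \<in> F \<Longrightarrow> u \<in> X \<Longrightarrow> v \<in> X \<Longrightarrow> dist u v < e p \<Longrightarrow> u \<in> T p \<longleftrightarrow> v \<in> T p"
    by metis
  \<comment> \<open>Inserting 1 keeps the minimum meaningful when \<open>F\<close> is empty; halving turns the strict bounds
    \<open>e p\<close> into the non-strict one demanded of \<open>\<epsilon>\<close>.\<close>
  define \<epsilon> where "\<epsilon> = Min (insert 1 (e ` F)) / 2"
  have eps: "\<epsilon> > 0" "\<And>p. p \<in> F \<Longrightarrow> \<epsilon> < e p"
  proof -
    have "Min (insert 1 (e ` F)) > 0"
      using F(2) e(1) by simp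
    moreover have "Min (insert 1 (e ` F)) \<le> e p" if "p \<in> F" for p
      using F(2) that by simp
    ultimately show "\<epsilon> > 0" "\<And>p. p \<in> F \<Longrightarrow> \<epsilon> < e p"
      unfolding \<epsilon>_def by (fastforce+)
  qed
  define c where "c u = {S \<in> T ` F. u \<in> S}" for u
  have c_iff: "c u = c v \<longleftrightarrow> (\<forall>p\<in>F. u \<in> T p \<longleftrightarrow> v \<in> T p)" for u v
    unfolding c_def by blast
  show thesis
  proof
    show "\<epsilon> > 0" by (rule eps)
    show "c u = c v" if "u \<in> X" "v \<in> X" "dist u v \<le> \<epsilon>" for u v
      using that eps e(2) unfolding c_iff by (meson le_less_trans)
    show "dist u v < \<eta>" if "u \<in> X" "v \<in> X" "c u = c v" for u v
    proof (rule ccontr)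
      assume "\<not> dist u v < \<eta>"
      with that have "(u, v) \<in> D" by (auto simp: D_def)
      then obtain p where "p \<in> F" "u \<in> U p" "v \<in> V p"
        using F(3) by blast
      then have "u \<in> T p" "v \<notin> T p"
        using TUV [of p] F(1) that by blast+
      with \<open>p \<in> F\<close> \<open>c u = c v\<close> show False
        by (auto simp: c_iff)
    qed
  qed
qed

section \<open>Returns in a separating system\<close>

lemma dyn_ball_subset_orbit:
  assumes "\<And>y. y \<in> X \<Longrightarrow> y \<notin> orbit X f x \<Longrightarrow> \<exists>n. dist (iter X f n x) (iter X f n y) > \<eta>"
  shows "dyn_ball X f \<eta> x \<subseteq> orbit X f x"
proof
  fix y assume "y \<in> dyn_ball X f \<eta> x"
  then have "y \<in> X" "\<not> (\<exists>n. dist (iter X f n x) (iter X f n y) > \<eta>)"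
    by (auto simp: dyn_ball_def not_less)
  with assms show "y \<in> orbit X f x" by blast
qed

text \<open>
  Every integer is \<open>j * n + r\<close> with \<open>r\<close> bounded by \<open>\<bar>n\<bar>\<close>, so the orbit is covered by finitely many
  images of the closure in the hypothesis, and by that hypothesis these images do not leave the orbit.
\<close>

lemma compact_orbit_if_closure_in_orbit:
  fixes X :: "'a::metric_space set"
  assumes comp: "compact X" and hom: "self_homeomorphism X f" and x: "x \<in> X" and "n \<noteq> 0"
    and clo: "closure (range (\<lambda>j. iter X f (j * n) x)) \<subseteq> orbit X f x"
  shows "compact (orbit X f x)"
proof -
  let ?C = "closure (range (\<lambda>j. iter X f (j * n) x))"
  \<comment> \<open>A symmetric range of remainders, because \<open>m mod n\<close> takes the sign of \<open>n\<close>.\<close>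
  let ?R = "{-\<bar>n\<bar>..\<bar>n\<bar>}"
  have CX: "?C \<subseteq> X"
    using clo orbit_subset [OF hom x] by blast
  then have "compact ?C"
    using comp by (metis closed_closure compact_Int_closed inf.absorb2)
  have "orbit X f x = (\<Union>r\<in>?R. iter X f r ` ?C)"
  proof
    show "(\<Union>r\<in>?R. iter X f r ` ?C) \<subseteq> orbit X f x"
      using clo by (fastforce simp: orbit_eq_range iter_add [OF hom x, symmetric])
    show "orbit X f x \<subseteq> (\<Union>r\<in>?R. iter X f r ` ?C)"
    proof
      fix y assume "y \<in> orbit X f x"
      then obtain m where "y = iter X f m x" by (auto simp: orbit_eq_range)
      then have "y = iter X f (m mod n) (iter X f ((m div n) * n) x)"
        using iter_add [OF hom x, of "m mod n" "(m div n) * n"] by simp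
      moreover have "m mod n \<in> ?R"
        using abs_mod_less [OF \<open>n \<noteq> 0\<close>, of m] by auto
      moreover have "iter X f ((m div n) * n) x \<in> ?C"
        by (intro closure_subset [THEN subsetD] rangeI)
      ultimately show "y \<in> (\<Union>r\<in>?R. iter X f r ` ?C)" by blast
    qed
  qed
  moreover have "compact (iter X f r ` ?C)" for r
    using \<open>compact ?C\<close> continuous_on_subset [OF continuous_on_iter [OF hom] CX]
    by (rule compact_continuous_image [rotated])
  ultimately show ?thesis
    by (simp add: compact_UN)
qed

text \<open>
  The points \<open>f\<^sup>j\<^sup>n(x)\<close> have the same itinerary as \<open>x\<close> and so never get far from it. The same bound
  holds for their limit points, which therefore remain in the orbit of \<open>x\<close>.
\<close>

lemma finite_orbit_if_periodic_itinerary: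
  fixes X :: "'a::metric_space set" and c :: "'a \<Rightarrow> 'b"
  assumes comp: "compact X" and hom: "self_homeomorphism X f" and x: "x \<in> X" and "n \<noteq> 0"
    and ball: "dyn_ball X f \<eta> x \<subseteq> orbit X f x"
    and fine: "\<And>u v. u \<in> X \<Longrightarrow> v \<in> X \<Longrightarrow> c u = c v \<Longrightarrow> dist u v < \<eta>"
    and per: "\<And>k. c (iter X f (k + n) x) = c (iter X f k x)"
  shows "finite (orbit X f x)"
proof -
  have col: "c (iter X f (k + j * n) x) = c (iter X f k x)" for j k
  proof (induction j rule: int_induct [where k = 0])
    case (step1 i)
    then show ?case using per [of "k + i * n"] by (simp add: algebra_simps)
  next
    case (step2 i)
    then show ?case using per [of "k + (i - 1) * n"] by (simp add: algebra_simps)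
  qed simp
  have "iter X f (j * n) x \<in> dyn_ball X f \<eta> x" for j
  proof -
    have "dist (iter X f k x) (iter X f k (iter X f (j * n) x)) \<le> \<eta>" for k
      unfolding iter_add [OF hom x, symmetric]
      by (intro less_imp_le fine iter_in hom x col [symmetric])
    then show ?thesis
      by (simp add: dyn_ball_def iter_in hom x)
  qed
  then have "closure (range (\<lambda>j. iter X f (j * n) x)) \<subseteq> dyn_ball X f \<eta> x"
    by (intro closure_minimal closed_dyn_ball comp hom) auto
  then show ?thesis
    using ball finite_compact_orbit [OF hom x]
      compact_orbit_if_closure_in_orbit [OF comp hom x \<open>n \<noteq> 0\<close>] by blast
qed

theorem theorem2p4:
  fixes X :: "'a::metric_space set" and f :: "'a \<Rightarrow> 'a"
  assumes "compact X" and "totally_disconnected X"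
    and "self_homeomorphism X f" and "separating X f"
  shows "finite_expansive X f \<and>
    (\<exists>\<epsilon>>0. \<forall>x\<in>X. dyn_ball X f \<epsilon> x \<noteq> {x} \<longrightarrow> periodic_point X f x)"
proof -
  note comp = assms(1) and hom = assms(3)
  obtain \<eta> where "\<eta> > 0" and ball: "\<And>x. x \<in> X \<Longrightarrow> dyn_ball X f \<eta> x \<subseteq> orbit X f x"
    using assms(4) dyn_ball_subset_orbit unfolding separating_def by metis
  obtain \<delta> and c :: "'a \<Rightarrow> 'a set set" where "\<delta> > 0"
    and close: "\<And>u v. u \<in> X \<Longrightarrow> v \<in> X \<Longrightarrow> dist u v \<le> \<delta> \<Longrightarrow> c u = c v"
    and fine: "\<And>u v. u \<in> X \<Longrightarrow> v \<in> X \<Longrightarrow> c u = c v \<Longrightarrow> dist u v < \<eta>"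
    using fine_locally_constant_colouring [OF comp assms(2) \<open>\<eta> > 0\<close>] by metis
  define \<epsilon> where "\<epsilon> = min \<delta> \<eta>"
  have "\<epsilon> > 0"
    using \<open>\<delta> > 0\<close> \<open>\<eta> > 0\<close> by (simp add: \<epsilon>_def)
  have sub: "dyn_ball X f \<epsilon> x \<subseteq> orbit X f x" if "x \<in> X" for x
    using ball [OF that] by (force simp: dyn_ball_def \<epsilon>_def)
  have fin: "finite (orbit X f x)" if x: "x \<in> X" and "dyn_ball X f \<epsilon> x \<noteq> {x}" for x
  proof -
    have "x \<in> dyn_ball X f \<epsilon> x"
      using x \<open>\<epsilon> > 0\<close> by (simp add: dyn_ball_def)
    with that(2) obtain y where y: "y \<in> dyn_ball X f \<epsilon> x" "y \<noteq> x"
      by blast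
    then obtain n where n: "y = iter X f n x"
      using sub [OF x] by (auto simp: orbit_eq_range)
    with y have "n \<noteq> 0" by auto
    have "dist (iter X f (k + n) x) (iter X f k x) \<le> \<delta>" for k
      using y by (simp add: dyn_ball_def \<epsilon>_def n iter_add [OF hom x] dist_commute)
    then have "c (iter X f (k + n) x) = c (iter X f k x)" for k
      by (intro close iter_in hom x)
    then show ?thesis
      using finite_orbit_if_periodic_itinerary [OF comp hom x \<open>n \<noteq> 0\<close> ball [OF x] fine] by blast
  qed
  have "finite (dyn_ball X f \<epsilon> x)" if "x \<in> X" for x
    using fin [OF that] sub [OF that] by (metis finite.emptyI finite.insertI finite_subset)
  then show ?thesis
    using \<open>\<epsilon> > 0\<close> fin periodic_point_if_finite_orbit [OF hom]
    unfolding finite_expansive_def by metis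
qed

end
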